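(* Let $E$ be a real separable Banach space and let $\mu$ be a Borel probability measure on $E$ with $\hat{\mu}(y)\ne 0$ for all $y\in E'$. Suppose the Urbanik decomposability semigroup $\mathbf{D}(\mu)$ contains a one-parameter $C_0$-semigroup $(T_t,t\ge 0)$, and for each $t\ge 0$ let $\rho_t:=\nu_{T_t}$ be the Borel probability measure with $\mu=T_t\mu\ast\nu_{T_t}$. Then the operators $$(\mathcal{T}_t f)(x)=\int_E f(T_t x+y)\,\rho_t(dy),\qquad f\in C_b(E),\ x\in E,\ t\ge 0,$$ form a generalized Mehler semigroup $(\mathcal{T}_t,t\ge 0)$.
   Context: $E'$ is the topological dual of $E$ and $\hat\mu(y)=\int_E e^{i\langle y,x\rangle}\mu(dx)$, $y\in E'$, is the Fourier transform. $C_b(E)$ is the space of real-valued bounded continuous functions on $E$. $\ast$ is convolution of measures; for a bounded linear operator $A$ on $E$, $A\mu$ is the image measure $(A\mu)(B)=\mu(\{x\in E:Ax\in B\})$. The Urbanik decomposability semigroup of $\mu$ is the set $\mathbf{D}(\mu)$ of all bounded linear operators $A$ on $E$ for which there exists a Borel probability measure $\nu_A$ on $E$ with $\mu=A\mu\ast\nu_A$ (when $\hat\mu$ has no zeros, $\nu_A$ is uniquely determined by $A$). A $C_0$-semigroup on $E$ is a family $(T_t)_{t\ge 0}$ of bounded linear operators with $T_0=I$, $T_tT_s=T_{t+s}$ for $s,t\ge0$, and $t\mapsto T_t x$ continuous for each $x\in E$. A generalized Mehler semigroup is a one-parameter semigroup of operators $(\mathcal{T}_t)_{t\ge 0}$ on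 $C_b(E)$ (i.e. $\mathcal{T}_t\mathcal{T}_s=\mathcal{T}_{t+s}$ for all $s,t\ge0$) of the form $(\mathcal{T}_t f)(x)=\int_E f(T_t x+y)\,\rho_t(dy)$ with $(T_t)_{t\ge 0}$ a $C_0$-semigroup on $E$ and $\rho_t$, $t\ge0$, Borel probability measures on $E$. *)

theory Defs
  imports "HOL-Probability.Probability"
begin

definition borel_probability :: "'a::topological_space measure \<Rightarrow> bool" where
  "borel_probability \<mu> \<longleftrightarrow> sets \<mu> = sets borel \<and> prob_space \<mu>"

definition fourier_transform ::
  "'a::real_normed_vector measure \<Rightarrow> ('a \<Rightarrow>\<^sub>L real) \<Rightarrow> complex" where
  "fourier_transform \<mu> y = (CLINT x|\<mu>. iexp (blinfun_apply y x))"

(* The library constant convolution has the same defining term, but its type is restricted to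
   ordered Euclidean spaces. *)
definition measure_convolution ::
  "'a::{banach, second_countable_topology} measure \<Rightarrow> 'a measure \<Rightarrow> 'a measure" where
  "measure_convolution \<mu> \<nu> = distr (\<mu> \<Otimes>\<^sub>M \<nu>) borel (\<lambda>(x, y). x + y)"

definition image_measure ::
  "('a::real_normed_vector \<Rightarrow>\<^sub>L 'a) \<Rightarrow> 'a measure \<Rightarrow> 'a measure" where
  "image_measure A \<mu> = distr \<mu> borel (blinfun_apply A)"

definition is_cofactor ::
  "'a::{banach, second_countable_topology} measure \<Rightarrow> ('a \<Rightarrow>\<^sub>L 'a) \<Rightarrow> 'a measure \<Rightarrow> bool" where
  "is_cofactor \<mu> A \<nu> \<longleftrightarrow>
     borel_probability \<nu> \<and> \<mu> = measure_convolution (image_measure A \<mu>) \<nu>"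

definition urbanik_semigroup ::
  "'a::{banach, second_countable_topology} measure \<Rightarrow> ('a \<Rightarrow>\<^sub>L 'a) set" where
  "urbanik_semigroup \<mu> = {A. \<exists>\<nu>. is_cofactor \<mu> A \<nu>}"

(* Families indexed by t >= 0 are functions on the reals; values at negative t are irrelevant. *)
definition C0_semigroup :: "(real \<Rightarrow> 'a::real_normed_vector \<Rightarrow>\<^sub>L 'a) \<Rightarrow> bool" where
  "C0_semigroup T \<longleftrightarrow>
     T 0 = id_blinfun \<and>
     (\<forall>s\<ge>0. \<forall>t\<ge>0. T (t + s) = T t o\<^sub>L T s) \<and>
     (\<forall>x. continuous_on {0..} (\<lambda>t. blinfun_apply (T t) x))"

definition mehler_operator ::
  "(real \<Rightarrow> 'a::real_normed_vector \<Rightarrow>\<^sub>L 'a) \<Rightarrow> (real \<Rightarrow> 'a measure) \<Rightarrow>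
     real \<Rightarrow> ('a \<Rightarrow> real) \<Rightarrow> 'a \<Rightarrow> real" where
  "mehler_operator T \<rho> t f = (\<lambda>x. LINT y|\<rho> t. f (blinfun_apply (T t) x + y))"

(* C_b(E) is the library set bcontfun; operators on it are maps on all real functions, constrained
   only on bcontfun, so that the invariance of C_b(E) is an explicit requirement. *)
definition generalized_mehler_semigroup ::
  "(real \<Rightarrow> ('a::{banach, second_countable_topology} \<Rightarrow> real) \<Rightarrow> 'a \<Rightarrow> real) \<Rightarrow> bool" where
  "generalized_mehler_semigroup P \<longleftrightarrow>
     (\<forall>t\<ge>0. \<forall>f\<in>bcontfun. P t f \<in> bcontfun) \<and>
     (\<forall>s\<ge>0. \<forall>t\<ge>0. \<forall>f\<in>bcontfun. P t (P s f) = P (t + s) f) \<and>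
     (\<exists>T \<rho>. C0_semigroup T \<and> (\<forall>t\<ge>0. borel_probability (\<rho> t)) \<and>
        (\<forall>t\<ge>0. \<forall>f\<in>bcontfun. P t f = mehler_operator T \<rho> t f))"

end

(* Hahn-Banach, obtained from a minimal sublinear functional below the norm, provides countably
   many functionals that determine the norm, so cylinder sets generate the Borel sets of E.
   Hence finite Borel measures with the same Fourier transform coincide. Now mu is the convolution
   of T_(t+s) mu with rho_(t+s), and also of T_(t+s) mu with T_s rho_t * rho_s; as the Fourier
   transform of mu has no zeros, rho_(t+s) = T_s rho_t * rho_s, which by Fubini's theorem is
   the semigroup law of the Mehler operators. *)
theory Submission
  imports Defs
begin

subsection \<open>Norming functionals\<close>

text \<open>A Fourier transform controls the law of one functional at a time, whereas a cylinder
  constrains several at once. The constraints are absorbed one by one: both measures are restricted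
  to the set where \<open>z\<close> takes values in \<open>B\<close>, and their Fourier data must be
  shown to agree still. Restrictions have arbitrary mass, hence uniqueness for finite measures. The
  data are kept as integrals of \<open>cos (y x + \<theta>)\<close>, since weights of the form one
  plus cosine are nonnegative and product-to-sum formulas keep this family closed. The shape of the
  convolution identity comes from inserting mu = T_t mu * rho_t into mu = T_s mu * rho_s; the factor
  cancelled is the transform of mu at y o T_(t+s).\<close>

definition sublinear :: "('a::real_vector \<Rightarrow> real) \<Rightarrow> bool" where
  "sublinear p \<longleftrightarrow>
     (\<forall>x y. p (x + y) \<le> p x + p y) \<and> (\<forall>c>0. \<forall>x. p (c *\<^sub>R x) \<le> c * p x)"

lemma sublinear_add: "sublinear p \<Longrightarrow> p (x + y) \<le> p x + p y"
  by (simp add: sublinear_def)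

lemma sublinear_0:
  assumes "sublinear p"
  shows "p 0 = 0"
proof -
  have "\<forall>x. p (2 *\<^sub>R x) \<le> 2 * p x" "\<forall>x. p ((1/2) *\<^sub>R x) \<le> (1/2) * p x"
    using assms unfolding sublinear_def by (meson zero_less_numeral half_gt_zero_iff zero_less_one)+
  from this[THEN spec, of 0] show ?thesis by simp
qed

text \<open>The inequality for the factor \<open>inverse c\<close> is the reverse inequality for
  \<open>c\<close>; \<open>sublinear\<close> therefore asks only for the half of homogeneity that
  passes easily to infima.\<close>

lemma sublinear_scaleR:
  assumes "sublinear p" "c \<ge> 0"
  shows "p (c *\<^sub>R x) = c * p x"
proof (cases "c = 0")
  case True
  then show ?thesis by (simp add: sublinear_0 assms)
next
  case False
  with assms have c: "c > 0" by simp
  have le: "p (c *\<^sub>R x) \<le> c * p x"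
    using assms c by (simp add: sublinear_def)
  have "p (inverse c *\<^sub>R (c *\<^sub>R x)) \<le> inverse c * p (c *\<^sub>R x)"
    using assms(1) c unfolding sublinear_def by (meson positive_imp_inverse_positive)
  then have "c * p x \<le> p (c *\<^sub>R x)"
    using c by (simp add: field_simps)
  with le show ?thesis by simp
qed

lemma sublinear_minus: "sublinear p \<Longrightarrow> - p (- x) \<le> p x"
  using sublinear_add[of p x "- x"] sublinear_0[of p] by simp

lemma sublinear_norm: "sublinear (norm :: 'a::real_normed_vector \<Rightarrow> real)"
  by (simp add: sublinear_def norm_triangle_ineq)

text \<open>A minimal \<open>p\<close> must equal the \<open>q\<close> built from it, which makes it
  superadditive. For \<open>p = norm\<close> the value of \<open>q\<close> at \<open>- x\<close>
  drops to \<open>- norm x\<close>. The parameters \<open>t = 0\<close> and \<open>t = 1\<close> of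
  the infimum give the two bounds.\<close>

lemma sublinear_lower:
  fixes p :: "'a::real_vector \<Rightarrow> real"
  assumes p: "sublinear p"
  obtains q where "sublinear q" "q \<le> p" "\<And>z. q z \<le> p (z + x) - p x"
proof -
  define q where "q z = (INF t\<in>{0..}. p (z + t *\<^sub>R x) - t * p x)" for z
  \<comment> \<open>Splitting \<open>t *\<^sub>R x\<close> as
    \<open>- z + (z + t *\<^sub>R x)\<close> yields the lower bound that makes the real infimum
    meaningful.\<close>
  have bdd: "bdd_below ((\<lambda>t. p (z + t *\<^sub>R x) - t * p x) ` {0..})" for z
  proof (rule bdd_belowI2)
    fix t :: real assume "t \<in> {0..}"
    then have "t * p x = p (- z + (z + t *\<^sub>R x))"
      by (simp add: sublinear_scaleR p)
    also have "\<dots> \<le> p (- z) + p (z + t *\<^sub>R x)"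
      by (rule sublinear_add[OF p])
    finally show "- p (- z) \<le> p (z + t *\<^sub>R x) - t * p x" by simp
  qed
  have upper: "q z \<le> p (z + t *\<^sub>R x) - t * p x" if "t \<ge> 0" for z t
    unfolding q_def using that by (intro cINF_lower bdd) auto
  have greatest: "m \<le> q z" if "\<And>t. t \<ge> 0 \<Longrightarrow> m \<le> p (z + t *\<^sub>R x) - t * p x" for z m
    unfolding q_def using that by (intro cINF_greatest) auto
  have "sublinear q"
    unfolding sublinear_def
  proof (intro conjI allI impI)
    fix z w :: 'a
    have "q (z + w) - (p (w + s *\<^sub>R x) - s * p x) \<le> q z" if s: "s \<ge> 0" for s
    proof (rule greatest)
      fix t :: real assume t: "t \<ge> 0"
      have "q (z + w) \<le> p ((z + t *\<^sub>R x) + (w + s *\<^sub>R x)) - (t + s) * p x"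
        using upper[of "t + s" "z + w"] s t by (simp add: algebra_simps)
      also have "\<dots> \<le> p (z + t *\<^sub>R x) + p (w + s *\<^sub>R x) - (t + s) * p x"
        using sublinear_add[OF p] by simp
      finally show "q (z + w) - (p (w + s *\<^sub>R x) - s * p x) \<le> p (z + t *\<^sub>R x) - t * p x"
        by (simp add: algebra_simps)
    qed
    then have "q (z + w) - q z \<le> q w"
      by (intro greatest) (simp add: algebra_simps)
    then show "q (z + w) \<le> q z + q w" by simp
  next
    fix c :: real and z :: 'a assume c: "c > 0"
    have "q (c *\<^sub>R z) / c \<le> q z"
    proof (rule greatest)
      fix t :: real assume t: "t \<ge> 0"
      have "q (c *\<^sub>R z) \<le> p (c *\<^sub>R (z + t *\<^sub>R x)) - (c * t) * p x"
        using upper[of "c * t" "c *\<^sub>R z"] c t by (simp add: scaleR_add_right)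
      also have "\<dots> = c * (p (z + t *\<^sub>R x) - t * p x)"
        using c by (subst sublinear_scaleR[OF p]) (auto simp: algebra_simps)
      finally show "q (c *\<^sub>R z) / c \<le> p (z + t *\<^sub>R x) - t * p x"
        using c by (simp add: field_simps)
    qed
    then show "q (c *\<^sub>R z) \<le> c * q z" using c by (simp add: field_simps)
  qed
  moreover have "q \<le> p"
    using upper[of 0] by (simp add: le_fun_def)
  moreover have "q z \<le> p (z + x) - p x" for z
    using upper[of 1 z] by simp
  ultimately show ?thesis by (rule that)
qed

text \<open>Zorn's lemma, with pointwise infima as lower bounds of chains; they are finite because
  every member satisfies \<open>- p (- x) \<le> - q (- x) \<le> q x\<close>.\<close>

lemma minimal_sublinear_exists:
  fixes p :: "'a::real_vector \<Rightarrow> real"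
  assumes p: "sublinear p"
  obtains m where "sublinear m" "m \<le> p" "\<And>q. sublinear q \<Longrightarrow> q \<le> m \<Longrightarrow> q = m"
proof -
  let ?A = "{q. sublinear q \<and> q \<le> p}"
  have "\<exists>m\<in>?A. \<forall>q\<in>?A. q \<le> m \<longrightarrow> q = m"
  \<comment> \<open>The order is reversed, so that maximal elements are minimal functionals.\<close>
  proof (rule predicate_Zorn)
    show "partial_order_on ?A (relation_of (\<lambda>a b. b \<le> a) ?A)"
      by (rule partial_order_on_relation_ofI) auto
  next
    fix C assume C: "C \<in> Chains (relation_of (\<lambda>a b :: 'a \<Rightarrow> real. b \<le> a) ?A)"
    have sub: "sublinear q" "q \<le> p" if "q \<in> C" for q
      using C that by (auto simp: Chains_def relation_of_def)
    have total: "q \<le> r \<or> r \<le> q" if "q \<in> C" "r \<in> C" for q r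
      using C that by (auto simp: Chains_def relation_of_def)
    show "\<exists>u\<in>?A. \<forall>q\<in>C. u \<le> q"
    proof (cases "C = {}")
      case True
      then show ?thesis using p by auto
    next
      case False
      define u where "u x = (INF q\<in>C. q x)" for x
      have bdd: "bdd_below ((\<lambda>q. q x) ` C)" for x
      proof (rule bdd_belowI2)
        fix q assume q: "q \<in> C"
        have "q (- x) \<le> p (- x)" using sub(2)[OF q] by (simp add: le_fun_def)
        with sublinear_minus[OF sub(1)[OF q], of x] show "- p (- x) \<le> q x" by linarith
      qed
      have upper: "u x \<le> q x" if "q \<in> C" for q x
        unfolding u_def using that by (intro cINF_lower bdd) auto
      have greatest: "m \<le> u x" if "\<And>q. q \<in> C \<Longrightarrow> m \<le> q x" for m x
        unfolding u_def using that False by (intro cINF_greatest) auto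
      have "sublinear u"
        unfolding sublinear_def
      proof (intro conjI allI impI)
        fix x y :: 'a
        have "u (x + y) - r y \<le> u x" if r: "r \<in> C" for r
        proof (rule greatest)
          fix q assume q: "q \<in> C"
          \<comment> \<open>Subadditivity of the infimum needs one functional below both
            \<open>q\<close> and \<open>r\<close>; totality of the chain provides it.\<close>
          obtain s where s: "s \<in> C" "s \<le> q" "s \<le> r"
            using total[OF q r] q r by blast
          have "u (x + y) \<le> s x + s y"
            using upper[OF s(1)] sublinear_add[OF sub(1)[OF s(1)]] by (rule order_trans)
          also have "\<dots> \<le> q x + r y" using s by (intro add_mono) (auto simp: le_fun_def)
          finally show "u (x + y) - r y \<le> q x" by simp
        qed
        then have "u (x + y) - u x \<le> u y"
          by (intro greatest) (simp add: algebra_simps)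
        then show "u (x + y) \<le> u x + u y" by simp
      next
        fix c :: real and x :: 'a assume c: "c > 0"
        have "u (c *\<^sub>R x) / c \<le> u x"
        proof (rule greatest)
          fix q assume q: "q \<in> C"
          show "u (c *\<^sub>R x) / c \<le> q x"
            using upper[OF q, of "c *\<^sub>R x"] c sublinear_scaleR[OF sub(1)[OF q], of c x]
            by (simp add: field_simps)
        qed
        then show "u (c *\<^sub>R x) \<le> c * u x" using c by (simp add: field_simps)
      qed
      moreover have "u \<le> q" if "q \<in> C" for q
        using upper[OF that] by (simp add: le_fun_def)
      ultimately show ?thesis using False sub(2) by (blast intro: order_trans)
    qed
  qed
  then show ?thesis using that by (auto intro: order_trans)
qed

text \<open>A minimal \<open>f\<close> coincides with its lowering along \<open>x\<close>, whose
  bound then reads \<open>f z + f x \<le> f (z + x)\<close>. Additivity makes \<open>f\<close> odd,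
  which extends homogeneity to negative scalars.\<close>

lemma linear_below_sublinear:
  fixes p :: "'a::real_vector \<Rightarrow> real"
  assumes "sublinear p"
  obtains f where "linear f" "f \<le> p"
proof -
  obtain f where f: "sublinear f" "f \<le> p" and min: "\<And>q. sublinear q \<Longrightarrow> q \<le> f \<Longrightarrow> q = f"
    using minimal_sublinear_exists[OF assms] by blast
  have "f z + f x \<le> f (z + x)" for x z
  proof -
    obtain q where q: "sublinear q" "q \<le> f" "\<And>z. q z \<le> f (z + x) - f x"
      using sublinear_lower[OF f(1)] by blast
    from min[OF q(1,2)] q(3)[of z] show ?thesis by (simp add: le_diff_eq)
  qed
  then have add: "f (x + y) = f x + f y" for x y
    by (intro antisym sublinear_add[OF f(1)])
  then have neg: "f (- x) = - f x" for x
    using add[of x "- x"] sublinear_0[OF f(1)] by simp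
  have "f (c *\<^sub>R x) = c *\<^sub>R f x" for c x
  proof (cases "c \<ge> 0")
    case False
    then show ?thesis
      using sublinear_scaleR[OF f(1), of "- c" x] neg[of "c *\<^sub>R x"] by simp
  qed (simp add: sublinear_scaleR[OF f(1)])
  with add have "linear f" by (intro linearI)
  with f(2) show ?thesis by (rule that[rotated])
qed

text \<open>Lowering the norm along \<open>x\<close> before choosing a linear functional forces
  \<open>f (- x) \<le> - norm x\<close>, so nothing has to be extended from the line through
  \<open>x\<close>.\<close>

lemma norming_functional:
  fixes x :: "'a::real_normed_vector"
  obtains f :: "'a \<Rightarrow>\<^sub>L real" where "\<And>z. \<bar>f z\<bar> \<le> norm z" "f x = norm x"
proof -
  obtain q where q: "sublinear q" "q \<le> norm" "\<And>z. q z \<le> norm (z + x) - norm x"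
    using sublinear_lower[OF sublinear_norm] by blast
  obtain f where f: "linear f" "f \<le> q" using linear_below_sublinear[OF q(1)] by blast
  have le: "f z \<le> norm z" for z
    using f(2) q(2) by (auto simp: le_fun_def intro: order_trans)
  have abs: "\<bar>f z\<bar> \<le> norm z" for z
    using le[of z] le[of "- z"] linear_neg[OF f(1), of z] by (simp add: abs_le_iff)
  have "f (- x) \<le> q (- x)" using f(2) by (simp add: le_fun_def)
  with q(3)[of "- x"] have "f x = norm x"
    using le[of x] linear_neg[OF f(1), of x] by simp
  moreover have "bounded_linear f"
    using f(1) abs by (intro bounded_linear_intro[where K = 1]) (auto simp: linear_add linear_cmul)
  ultimately show ?thesis
    using that[of "Blinfun f"] abs by (simp add: bounded_linear_Blinfun_apply)
qed

text \<open>Functionals norming the points of a dense set suffice, because they are 1-Lipschitz.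
  Closed balls thereby become countable intersections of strips.\<close>

lemma countable_norming_set:
  obtains Y :: "('a::{real_normed_vector, second_countable_topology} \<Rightarrow>\<^sub>L real) set"
  where "countable Y" "\<And>x r. norm x \<le> r \<longleftrightarrow> (\<forall>y\<in>Y. \<bar>y x\<bar> \<le> r)"
proof -
  obtain D :: "'a set" where D: "countable D" "\<And>X. open X \<Longrightarrow> X \<noteq> {} \<Longrightarrow> \<exists>d\<in>D. d \<in> X"
    by (rule countable_dense_setE) blast
  have "\<forall>d. \<exists>f :: 'a \<Rightarrow>\<^sub>L real. (\<forall>z. \<bar>f z\<bar> \<le> norm z) \<and> f d = norm d"
    using norming_functional by metis
  then obtain F :: "'a \<Rightarrow> 'a \<Rightarrow>\<^sub>L real"
    where F: "\<And>d z. \<bar>F d z\<bar> \<le> norm z" "\<And>d. F d d = norm d"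
    by metis
  have "norm x \<le> r \<longleftrightarrow> (\<forall>y\<in>F ` D. \<bar>y x\<bar> \<le> r)" for x r
  proof
    assume *: "\<forall>y\<in>F ` D. \<bar>y x\<bar> \<le> r"
    have "norm x \<le> r + e" if e: "e > 0" for e
    proof -
      \<comment> \<open>The distance is lost twice, in passing from \<open>x\<close> to
        \<open>d\<close> in the norm and in the functional; hence \<open>e / 2\<close>.\<close>
      obtain d where d: "d \<in> D" "dist x d < e / 2"
        using D(2)[of "ball x (e / 2)"] e by auto
      have "norm x \<le> F d d + dist x d"
        using norm_triangle_ineq2[of x d] by (simp add: F dist_norm)
      also have "F d d = F d x - F d (x - d)" by (simp add: blinfun.diff_right)
      also have "\<dots> \<le> r + dist x d"
        using * d(1) F(1)[of d "x - d"] by (auto simp: dist_norm abs_le_iff)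
      finally show ?thesis using d(2) by simp
    qed
    then show "norm x \<le> r" by (rule field_le_epsilon)
  qed (auto intro: order_trans F)
  with D(1) show ?thesis by (intro that[of "F ` D"]) auto
qed

subsection \<open>Uniqueness of the Fourier transform\<close>

lemma integrable_bounded_borel:
  fixes f :: "'a \<Rightarrow> 'b::{banach, second_countable_topology}"
  assumes "finite_measure M" "f \<in> borel_measurable M" "\<And>x. norm (f x) \<le> B"
  shows "integrable M f"
  using assms by (intro finite_measure.integrable_const_bound[where B = B]) auto

lemma integral_iexp:
  assumes M: "finite_measure M" and g[measurable]: "g \<in> borel_measurable M"
  shows "(CLINT x|M. iexp (g x)) = Complex (LINT x|M. cos (g x)) (LINT x|M. sin (g x))"
proof -
  have "integrable M (\<lambda>x. iexp (g x))"
    by (rule integrable_bounded_borel[OF M, where B = 1]) auto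
  then show ?thesis
    by (simp add: complex_eq_iff flip: integral_Re integral_Im)
       (simp add: Re_exp Im_exp)
qed

text \<open>Cosines of arbitrary phase contain both parts of the characteristic function, and
  dividing by the common mass reduces the claim to Levy's theorem for probability measures.\<close>

lemma finite_real_measure_eqI_cos:
  fixes M N :: "real measure"
  assumes M: "finite_measure M" "sets M = sets borel"
    and N: "finite_measure N" "sets N = sets borel"
    and eq: "\<And>t \<theta>. (LINT x|M. cos (t * x + \<theta>)) = (LINT x|N. cos (t * x + \<theta>))"
  shows "M = N"
proof -
  define c where "c = measure M (space M)"
  note [measurable_cong] = M(2) N(2)
  have space: "space M = UNIV" "space N = UNIV"
    using M(2) N(2) by (auto dest: sets_eq_imp_space_eq)
  have cN: "c = measure N (space N)"
    using eq[of 0 0] by (simp add: c_def)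
  have eM: "emeasure M (space M) = ennreal c" and eN: "emeasure N (space N) = ennreal c"
    by (auto simp: c_def cN finite_measure.emeasure_eq_measure[OF M(1)]
        finite_measure.emeasure_eq_measure[OF N(1)] simp flip: c_def cN)
  show ?thesis
  proof (cases "c = 0")
    case True
    show ?thesis
    proof (rule measure_eqI)
      fix A
      have "emeasure M A \<le> emeasure M (space M)" "emeasure N A \<le> emeasure N (space N)"
        by (rule emeasure_space)+
      then show "emeasure M A = emeasure N A" by (simp add: eM eN True)
    qed (simp add: M N)
  next
    case False
    then have c: "c > 0" by (simp add: c_def zero_less_measure_iff)
    have prob: "real_distribution (density L (\<lambda>_. ennreal (1 / c)))"
      if "sets L = sets borel" "emeasure L (space L) = ennreal c" for L :: "real measure"
      using that c
      by (intro real_distribution.intro prob_spaceI real_distribution_axioms.intro)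
         (auto simp: emeasure_density_const simp flip: ennreal_mult)
    have char: "char (density L (\<lambda>_. ennreal (1 / c))) t =
        (1 / c) *\<^sub>R Complex (LINT x|L. cos (t * x)) (LINT x|L. sin (t * x))"
      if "finite_measure L" "sets L = sets borel" for L :: "real measure" and t
      unfolding char_def using that c
      by (subst integral_density) (simp_all add: measurable_cong_sets[OF that(2) refl]
           integral_iexp[where g = "\<lambda>x. t * x", simplified])
    \<comment> \<open>The phase \<open>- (pi / 2)\<close> turns the cosine into a sine.\<close>
    have "(LINT x|M. cos (t * x)) = (LINT x|N. cos (t * x))"
         "(LINT x|M. sin (t * x)) = (LINT x|N. sin (t * x))" for t
      using eq[of t 0] eq[of t "- (pi / 2)"] by (simp_all add: cos_diff)
    then have "density M (\<lambda>_. ennreal (1 / c)) = density N (\<lambda>_. ennreal (1 / c))"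
      by (intro Levy_uniqueness prob eM eN M N ext) (simp add: char M N)
    then have *: "ennreal (1 / c) * emeasure M A = ennreal (1 / c) * emeasure N A"
      if "A \<in> sets borel" for A
      using that M N by (metis emeasure_density_const)
    show ?thesis
    proof (rule measure_eqI)
      fix A assume "A \<in> sets M"
      then show "emeasure M A = emeasure N A"
        using *[of A] c by (simp add: M ennreal_mult_cancel_left)
    qed (simp add: M N)
  qed
qed

lemma blinfun_measurable[measurable]: "blinfun_apply f \<in> borel_measurable borel"
  by (intro borel_measurable_continuous_onI continuous_intros)

text \<open>The weight \<open>1 + cos (y x + \<theta>)\<close> is nonnegative, so the weighted measures have laws under \<open>z\<close>
  to which the one-dimensional uniqueness theorem applies.\<close>

lemma cos_integrals_restrict:
  fixes M N :: "'a::real_normed_vector measure" and y z :: "'a \<Rightarrow>\<^sub>L real"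
  assumes M: "finite_measure M" "sets M = sets borel"
    and N: "finite_measure N" "sets N = sets borel"
    and eq: "\<And>(y :: 'a \<Rightarrow>\<^sub>L real) \<theta>.
      (LINT x|M. cos (blinfun_apply y x + \<theta>)) = (LINT x|N. cos (blinfun_apply y x + \<theta>))"
    and B[measurable]: "B \<in> sets borel"
  shows "(LINT x|M. indicator B (z x) * cos (y x + \<theta>)) = (LINT x|N. indicator B (z x) * cos (y x + \<theta>))"
proof -
  define w where "w y \<theta> x = 1 + cos (blinfun_apply y x + \<theta>)" for y :: "'a \<Rightarrow>\<^sub>L real" and \<theta> x
  have w_nonneg: "0 \<le> w y \<theta> x" and w_le: "w y \<theta> x \<le> 2" for y \<theta> x
    using cos_ge_minus_one[of "y x + \<theta>"] cos_le_one[of "y x + \<theta>"] unfolding w_def by linarith+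
  have w_meas[measurable]: "w y \<theta> \<in> borel_measurable borel" for y \<theta>
    unfolding w_def by measurable
  have int: "integrable L f"
    if "finite_measure L" "sets L = sets borel" "f \<in> borel_measurable borel" "\<And>x. norm (f x) \<le> b"
    for L :: "'a measure" and f :: "'a \<Rightarrow> real" and b
    using that by (intro integrable_bounded_borel) (simp_all add: measurable_cong_sets[OF that(2) refl])
  define law where "law L y \<theta> = distr (density L (w y \<theta>)) borel z" for L y \<theta>
  have law_integral: "(LINT u|law L y \<theta>. g u) = (LINT x|L. w y \<theta> x * g (z x))"
    if "finite_measure L" "sets L = sets borel" "g \<in> borel_measurable borel"
    for L :: "'a measure" and y \<theta> and g :: "real \<Rightarrow> real"
  proof -
    note [measurable_cong] = that(2)
    note [measurable] = that(3)
    show ?thesis unfolding law_def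
      by (subst integral_distr) (simp_all add: integral_density w_nonneg)
  qed
  have law_finite: "finite_measure (law L y \<theta>)" if L: "finite_measure L" "sets L = sets borel"
    for L :: "'a measure" and y \<theta>
  proof -
    note [measurable_cong] = L(2)
    have "integrable L (w y \<theta>)"
      using w_nonneg w_le by (intro int[OF L, where b = 2]) auto
    then have "emeasure (density L (w y \<theta>)) (space L) < \<infinity>"
      by (simp add: emeasure_density nn_integral_eq_integral w_nonneg cong: nn_integral_cong)
    then show ?thesis unfolding law_def
      by (intro finite_measure.finite_measure_distr finite_measureI) auto
  qed
  \<comment> \<open>The product-to-sum formula splits a weighted cosine into cosines along
    \<open>t *\<^sub>R z\<close> and \<open>t *\<^sub>R z\<close> plus or minus \<open>y\<close>, to
    all of which \<open>eq\<close> applies.\<close>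
  have law_cos: "(LINT u|law L y \<theta>. cos (t * u + \<phi>)) =
      (LINT x|L. cos ((t *\<^sub>R z) x + \<phi>)) + (LINT x|L. cos ((t *\<^sub>R z + y) x + (\<phi> + \<theta>))) / 2
      + (LINT x|L. cos ((t *\<^sub>R z - y) x + (\<phi> - \<theta>))) / 2"
    if L: "finite_measure L" "sets L = sets borel" for L :: "'a measure" and y \<theta> t \<phi>
  proof -
    have cos_int: "integrable L (\<lambda>x. cos (blinfun_apply v x + \<psi>))" for v and \<psi> :: real
      by (rule int[OF L, where b = 1]) auto
    have "(LINT u|law L y \<theta>. cos (t * u + \<phi>)) = (LINT x|L. w y \<theta> x * cos (t * z x + \<phi>))"
      using L by (rule law_integral) simp
    also have "\<dots> = (LINT x|L. cos ((t *\<^sub>R z) x + \<phi>) + cos ((t *\<^sub>R z + y) x + (\<phi> + \<theta>)) / 2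
      + cos ((t *\<^sub>R z - y) x + (\<phi> - \<theta>)) / 2)"
    proof (rule Bochner_Integration.integral_cong[OF refl])
      fix x
      have "cos (y x + \<theta>) * cos (t * z x + \<phi>) =
          (cos ((t * z x + \<phi>) + (y x + \<theta>)) + cos ((t * z x + \<phi>) - (y x + \<theta>))) / 2"
        by (simp add: cos_add cos_diff)
      then show "w y \<theta> x * cos (t * z x + \<phi>) = cos ((t *\<^sub>R z) x + \<phi>)
          + cos ((t *\<^sub>R z + y) x + (\<phi> + \<theta>)) / 2 + cos ((t *\<^sub>R z - y) x + (\<phi> - \<theta>)) / 2"
        by (simp add: w_def distrib_right blinfun.bilinear_simps add_divide_distrib algebra_simps)
    qed
    also have "\<dots> = (LINT x|L. cos ((t *\<^sub>R z) x + \<phi>)) + (LINT x|L. cos ((t *\<^sub>R z + y) x + (\<phi> + \<theta>))) / 2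
      + (LINT x|L. cos ((t *\<^sub>R z - y) x + (\<phi> - \<theta>))) / 2"
      by (simp add: cos_int)
    finally show ?thesis .
  qed
  have "law M y \<theta> = law N y \<theta>" for y \<theta>
    by (rule finite_real_measure_eqI_cos)
       (auto simp: law_finite M N law_cos eq, simp_all add: law_def)
  then have weighted: "(LINT x|M. w y \<theta> x * indicator B (z x)) = (LINT x|N. w y \<theta> x * indicator B (z x))" for y \<theta>
    using law_integral[OF M, of "indicator B" y \<theta>] law_integral[OF N, of "indicator B" y \<theta>] by simp
  \<comment> \<open>\<open>w 0 (pi / 2)\<close> is the constant 1, so the difference leaves only the
    cosine of the weight.\<close>
  have split: "(LINT x|L. indicator B (z x) * cos (y x + \<theta>)) =
      (LINT x|L. w y \<theta> x * indicator B (z x)) - (LINT x|L. w 0 (pi / 2) x * indicator B (z x))"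
    if L: "finite_measure L" "sets L = sets borel" for L :: "'a measure"
  proof -
    have w_int: "integrable L (\<lambda>x. w y \<theta> x * indicator B (z x))" for y \<theta>
      using w_nonneg w_le by (intro int[OF L, where b = 2]) (auto split: split_indicator)
    show ?thesis
      by (subst Bochner_Integration.integral_diff[OF w_int w_int, symmetric])
         (auto intro!: Bochner_Integration.integral_cong simp: w_def algebra_simps)
  qed
  show ?thesis by (simp add: split M N weighted)
qed

section \<open>Cylinder sets as a determining class and generator\<close>

lemma cylinder_measurable:
  assumes "\<forall>(z, B)\<in>set L. B \<in> sets borel"
  shows "{x. \<forall>(z, B)\<in>set L. blinfun_apply z x \<in> B} \<in> sets borel"
  using assms
proof (induction L)
  case (Cons p L)
  obtain z B where p: "p = (z, B)" by (cases p)
  have "{x. \<forall>(z, B)\<in>set (p # L). blinfun_apply z x \<in> B} =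
      (blinfun_apply z -` B \<inter> space borel) \<inter> {x. \<forall>(z, B)\<in>set L. blinfun_apply z x \<in> B}"
    by (auto simp: p)
  moreover have "blinfun_apply z -` B \<inter> space borel \<in> sets borel"
    using Cons.prems by (intro measurable_sets[OF blinfun_measurable]) (auto simp: p)
  ultimately show ?case
    using Cons by (auto simp: p)
qed simp

text \<open>Induction on the list of constraints, for arbitrary measures: the first constraint is
  absorbed by restricting both measures to it, and \<open>cos_integrals_restrict\<close> transfers
  the cosine hypothesis to the restrictions.\<close>

lemma emeasure_cylinder_eqI:
  fixes M N :: "'a::real_normed_vector measure" and L :: "(('a \<Rightarrow>\<^sub>L real) \<times> real set) list"
  assumes "finite_measure M" "sets M = sets borel"
    and "finite_measure N" "sets N = sets borel"
    and "\<And>(y :: 'a \<Rightarrow>\<^sub>L real) \<theta>.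
      (LINT x|M. cos (blinfun_apply y x + \<theta>)) = (LINT x|N. cos (blinfun_apply y x + \<theta>))"
    and "\<forall>(z, B)\<in>set L. B \<in> sets borel"
  shows "emeasure M {x. \<forall>(z, B)\<in>set L. blinfun_apply z x \<in> B} =
         emeasure N {x. \<forall>(z, B)\<in>set L. blinfun_apply z x \<in> B}"
  using assms
proof (induction L arbitrary: M N)
  case Nil
  have "space M = UNIV" "space N = UNIV"
    using Nil(2,4) by (auto dest: sets_eq_imp_space_eq)
  \<comment> \<open>The empty list describes the whole space, whose mass is the cosine integral for
    the zero functional and zero phase.\<close>
  with Nil(5)[of 0 0] show ?case
    by (simp add: finite_measure.emeasure_eq_measure[OF Nil(1)]
        finite_measure.emeasure_eq_measure[OF Nil(3)])
next
  case (Cons p L)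
  obtain z B where p: "p = (z, B)" by (cases p)
  have B[measurable]: "B \<in> sets borel" and L: "\<forall>(z, B)\<in>set L. B \<in> sets borel"
    using Cons.prems(6) by (auto simp: p)
  let ?S = "blinfun_apply z -` B" and ?C = "{x. \<forall>(z, B)\<in>set L. blinfun_apply z x \<in> B}"
  have S[measurable]: "?S \<in> sets borel"
    using measurable_sets[OF blinfun_measurable B, of z] by simp
  have eq: "{x. \<forall>(z, B)\<in>set (p # L). blinfun_apply z x \<in> B} = ?S \<inter> ?C"
    by (auto simp: p)
  have restr: "emeasure (density K (indicator ?S)) ?C = emeasure K (?S \<inter> ?C)"
    if "sets K = sets borel" for K
    using that S cylinder_measurable[OF L] by (intro emeasure_restricted) simp_all
  have cos_meas: "(\<lambda>x. cos (blinfun_apply y x + \<theta>)) \<in> borel_measurable borel"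
    for y :: "'a \<Rightarrow>\<^sub>L real" and \<theta>
    by measurable
  have fin: "finite_measure (density K (indicator ?S))"
    if "finite_measure K" "sets K = sets borel" for K
    using that by (intro finite_measure.finite_measure_restricted) auto
  have int: "(LINT x|density K (indicator ?S). f x) = (LINT x|K. indicator B (z x) * f x)"
    if "sets K = sets borel" "f \<in> borel_measurable borel" for K and f :: "'a \<Rightarrow> real"
  proof -
    note [measurable_cong] = that(1)
    note [measurable] = that(2)
    have "density K (indicator ?S) = density K (\<lambda>x. ennreal (indicator B (z x)))"
      by (rule arg_cong[where f = "density K"]) (auto split: split_indicator)
    then show ?thesis by (simp add: integral_density)
  qed
  have cos_eq: "(LINT x|density M (indicator ?S). cos (blinfun_apply y x + \<theta>)) =
      (LINT x|density N (indicator ?S). cos (blinfun_apply y x + \<theta>))"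
    for y :: "'a \<Rightarrow>\<^sub>L real" and \<theta> :: real
    using cos_integrals_restrict[OF Cons.prems(1-5) B]
    by (simp only: int[OF Cons.prems(2) cos_meas] int[OF Cons.prems(4) cos_meas])
  have "emeasure (density M (indicator ?S)) ?C = emeasure (density N (indicator ?S)) ?C"
    by (rule Cons.IH[OF fin[OF Cons.prems(1,2)] _ fin[OF Cons.prems(3,4)] _ cos_eq L])
       (simp_all only: sets_density Cons.prems)
  then show ?case
    unfolding eq using Cons.prems(2,4) by (simp add: restr)
qed

text \<open>Separability enters twice: the norming set makes closed balls countable intersections of
  cylinders with one constraint, and dense centres with rational radii make open sets countable
  unions of closed balls.\<close>

lemma borel_eq_sigma_cylinders:
  "sets (borel :: 'a::{real_normed_vector, second_countable_topology} measure) =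
     sigma_sets UNIV {{x. \<forall>(z, B)\<in>set L. blinfun_apply z x \<in> B} |
       L :: (('a \<Rightarrow>\<^sub>L real) \<times> real set) list. \<forall>(z, B)\<in>set L. B \<in> sets borel}"
  (is "_ = sigma_sets UNIV ?E")
proof
  show "sigma_sets UNIV ?E \<subseteq> sets borel"
    using cylinder_measurable sets.sigma_sets_subset[of ?E borel] by auto
  obtain Y :: "('a \<Rightarrow>\<^sub>L real) set"
    where Y: "countable Y" "\<And>x r. norm x \<le> r \<longleftrightarrow> (\<forall>y\<in>Y. \<bar>y x\<bar> \<le> r)"
    using countable_norming_set by blast
  obtain D :: "'a set" where D: "countable D" "\<And>X. open X \<Longrightarrow> X \<noteq> {} \<Longrightarrow> \<exists>d\<in>D. d \<in> X"
    by (rule countable_dense_setE) blast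
  have cball: "cball d r \<in> sets (sigma UNIV ?E)" for d r
  proof -
    have "(\<Inter>y\<in>Y. {x. \<bar>blinfun_apply y (d - x)\<bar> \<le> r}) \<in> sets (sigma UNIV ?E)"
    proof (rule sets.countable_INT''[OF _ Y(1)])
      fix y assume "y \<in> Y"
      have "{x. \<bar>blinfun_apply y (d - x)\<bar> \<le> r} \<in> ?E"
        by (intro CollectI exI[of _ "[(y, {y d - r..y d + r})]"])
           (auto simp: blinfun.diff_right abs_le_iff)
      then show "{x. \<bar>blinfun_apply y (d - x)\<bar> \<le> r} \<in> sets (sigma UNIV ?E)" by auto
    next
      show "UNIV \<in> sets (sigma UNIV ?E)"
        using sets.top[of "sigma UNIV ?E"] by simp
    qed
    also have "(\<Inter>y\<in>Y. {x. \<bar>blinfun_apply y (d - x)\<bar> \<le> r}) = cball d r"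
      by (auto simp: dist_norm Y(2))
    finally show ?thesis .
  qed
  have "U \<in> sets (sigma UNIV ?E)" if U: "open U" for U :: "'a set"
  proof -
    let ?I = "{(d, r) \<in> D \<times> \<rat>. cball d r \<subseteq> U}"
    have "(\<Union>(d, r)\<in>?I. cball d r) \<in> sets (sigma UNIV ?E)"
    proof (rule sets.countable_UN')
      show "countable ?I"
        by (rule countable_subset[of _ "D \<times> \<rat>"]) (auto intro: D countable_rat)
    qed (use cball in auto)
    also have "(\<Union>(d, r)\<in>?I. cball d r) = U"
    proof (intro antisym subsetI)
      fix x assume "x \<in> U"
      with U obtain e where e: "e > 0" "ball x e \<subseteq> U" using open_contains_ball by blast
      \<comment> \<open>A ball of radius \<open>r\<close> about a point within \<open>r\<close> of
        \<open>x\<close> stays within \<open>2 * r < e\<close> of \<open>x\<close>.\<close>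
      obtain r where r: "r \<in> \<rat>" "0 < r" "r < e / 2"
        using Rats_dense_in_real[of 0 "e / 2"] e(1) by auto
      obtain d where d: "d \<in> D" "dist x d < r"
        using D(2)[of "ball x r"] r(2) by auto
      have "cball d r \<subseteq> U"
      proof
        fix u assume "u \<in> cball d r"
        then have "dist x u < e"
          using d(2) r(3) dist_triangle[of x u d] by simp
        then show "u \<in> U" using e(2) by auto
      qed
      with d r show "x \<in> (\<Union>(d, r)\<in>?I. cball d r)"
        by (auto simp: dist_commute intro!: exI[of _ d] exI[of _ r])
    qed auto
    finally show ?thesis .
  qed
  then show "sets borel \<subseteq> sigma_sets UNIV ?E"
    unfolding borel_def by (auto simp: sets_measure_of_conv intro!: sigma_sets_mono)
qed

text \<open>Intersecting cylinders appends their lists, so they form an intersection-stable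
  generator containing the whole space, and agreement on them suffices for finite measures.\<close>

theorem finite_measure_eqI_fourier:
  fixes M N :: "'a::{real_normed_vector, second_countable_topology} measure"
  assumes M: "finite_measure M" "sets M = sets borel"
    and N: "finite_measure N" "sets N = sets borel"
    and eq: "\<And>y. fourier_transform M y = fourier_transform N y"
  shows "M = N"
proof -
  have iexp: "fourier_transform K y = Complex (LINT x|K. cos (y x)) (LINT x|K. sin (y x))"
    if "finite_measure K" "sets K = sets borel" for K :: "'a measure" and y :: "'a \<Rightarrow>\<^sub>L real"
    using that(1) unfolding fourier_transform_def
    by (rule integral_iexp) (simp add: measurable_cong_sets[OF that(2) refl])
  \<comment> \<open>The addition formula recovers every phase from the real and imaginary
    parts.\<close>
  have cos: "(LINT x|K. cos (y x + \<theta>)) =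
      cos \<theta> * Re (fourier_transform K y) - sin \<theta> * Im (fourier_transform K y)"
    if K: "finite_measure K" "sets K = sets borel" for K :: "'a measure" and y :: "'a \<Rightarrow>\<^sub>L real" and \<theta>
  proof -
    have "integrable K (\<lambda>x. cos (y x))" "integrable K (\<lambda>x. sin (y x))"
      by (auto intro!: integrable_bounded_borel[OF K(1), where B = 1]
          simp: measurable_cong_sets[OF K(2) refl])
    then show ?thesis
      by (simp add: iexp[OF K] cos_add mult.commute)
  qed
  let ?E = "{{x. \<forall>(z, B)\<in>set L. blinfun_apply z x \<in> B} |
    L :: (('a \<Rightarrow>\<^sub>L real) \<times> real set) list. \<forall>(z, B)\<in>set L. B \<in> sets borel}"
  show ?thesis
  proof (rule measure_eqI_generator_eq)
    show "Int_stable ?E"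
    proof (rule Int_stableI)
      fix X X' assume "X \<in> ?E" and "X' \<in> ?E"
      then obtain K L :: "(('a \<Rightarrow>\<^sub>L real) \<times> real set) list"
        where K: "X = {x. \<forall>(z, B)\<in>set K. blinfun_apply z x \<in> B}" "\<forall>(z, B)\<in>set K. B \<in> sets borel"
          and L: "X' = {x. \<forall>(z, B)\<in>set L. blinfun_apply z x \<in> B}" "\<forall>(z, B)\<in>set L. B \<in> sets borel"
        by blast
      have "X \<inter> X' = {x. \<forall>(z, B)\<in>set (K @ L). blinfun_apply z x \<in> B}"
        unfolding K(1) L(1) set_append ball_Un by (rule Collect_conj_eq[symmetric])
      moreover have "\<forall>(z, B)\<in>set (K @ L). B \<in> sets borel"
        unfolding set_append ball_Un using K(2) L(2) by (rule conjI)
      ultimately show "X \<inter> X' \<in> ?E"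
        by (intro CollectI exI conjI)
    qed
    show "emeasure M X = emeasure N X" if X: "X \<in> ?E" for X
    proof -
      obtain L :: "(('a \<Rightarrow>\<^sub>L real) \<times> real set) list"
        where L: "X = {x. \<forall>(z, B)\<in>set L. blinfun_apply z x \<in> B}" "\<forall>(z, B)\<in>set L. B \<in> sets borel"
        using X by blast
      show ?thesis
        unfolding L(1)
        by (rule emeasure_cylinder_eqI[OF M N _ L(2)]) (simp only: cos[OF M] cos[OF N] eq)
    qed
    show "sets M = sigma_sets UNIV ?E" "sets N = sigma_sets UNIV ?E"
      using M(2) N(2) borel_eq_sigma_cylinders by auto
    show "range (\<lambda>_::nat. UNIV) \<subseteq> ?E"
      by (auto intro!: exI[of _ "[]"])
    show "emeasure M UNIV \<noteq> \<infinity>"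
      using finite_measure.emeasure_finite[OF M(1)] by simp
  qed auto
qed

subsection \<open>Convolutions and Mehler operators\<close>

lemma borel_probabilityD:
  assumes "borel_probability M"
  shows "sets M = sets borel" "prob_space M" "finite_measure M"
  using assms by (auto simp: borel_probability_def prob_space_def)

lemma borel_probability_image:
  assumes "borel_probability M"
  shows "borel_probability (image_measure A M)"
  unfolding borel_probability_def image_measure_def
  using borel_probabilityD(2)[OF assms]
  by (auto intro!: prob_space.prob_space_distr
      simp: measurable_cong_sets[OF borel_probabilityD(1)[OF assms] refl])

lemma borel_probability_convolution:
  assumes "borel_probability M" "borel_probability N"
  shows "borel_probability (measure_convolution M N)"
proof -
  note [measurable_cong] = borel_probabilityD(1)[OF assms(1)] borel_probabilityD(1)[OF assms(2)]
  show ?thesis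
    unfolding borel_probability_def measure_convolution_def
    using borel_probabilityD(2)[OF assms(1)] borel_probabilityD(2)[OF assms(2)]
    by (auto intro!: prob_space.prob_space_distr prob_space_pair)
qed

text \<open>Boundedness supplies the integrability for Fubini's theorem. Banach-valued integrands
  cover both complex exponentials and the real integrands of the Mehler operators.\<close>

lemma integral_measure_convolution:
  fixes f :: "'a::{banach, second_countable_topology} \<Rightarrow> 'b::{banach, second_countable_topology}"
  assumes "borel_probability M" "borel_probability N"
    and f[measurable]: "f \<in> borel_measurable borel" and bound: "\<And>x. norm (f x) \<le> b"
  shows "(LINT z|measure_convolution M N. f z) = (LINT x|M. LINT y|N. f (x + y))"
proof -
  note M = borel_probabilityD[OF assms(1)] and N = borel_probabilityD[OF assms(2)]
  note [measurable_cong] = M(1) N(1)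
  interpret M: prob_space M by (rule M)
  interpret N: prob_space N by (rule N)
  interpret pair_prob_space M N ..
  have "integrable (M \<Otimes>\<^sub>M N) (\<lambda>(x, y). f (x + y))"
    by (rule integrable_bounded_borel[where B = b]) (auto simp: bound)
  from integral_fst[OF this] show ?thesis
    unfolding measure_convolution_def by (subst integral_distr) (auto simp: split_beta')
qed

lemma fourier_transform_image:
  assumes "borel_probability M"
  shows "fourier_transform (image_measure A M) y = fourier_transform M (y o\<^sub>L A)"
  unfolding fourier_transform_def image_measure_def
  by (subst integral_distr)
     (simp_all add: measurable_cong_sets[OF borel_probabilityD(1)[OF assms] refl])

lemma fourier_transform_convolution:
  assumes "borel_probability M" "borel_probability N"
  shows "fourier_transform (measure_convolution M N) y = fourier_transform M y * fourier_transform N y"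
proof -
  have "fourier_transform (measure_convolution M N) y =
      (CLINT x|M. CLINT z|N. iexp (y x) * iexp (y z))"
    unfolding fourier_transform_def
    by (subst integral_measure_convolution[OF assms, where b = 1])
       (auto simp: blinfun.add_right distrib_left exp_add)
  then show ?thesis
    by (simp add: fourier_transform_def)
qed

text \<open>Convolved with the image of \<open>\<mu>\<close> under \<open>A \<circ> B\<close>, both sides give
  \<open>\<mu>\<close>, so their Fourier transforms agree wherever that of \<open>\<mu>\<close> does not vanish.\<close>

lemma cofactor_compose:
  fixes \<mu> :: "'a::{banach, second_countable_topology} measure"
  assumes \<mu>: "borel_probability \<mu>" "\<And>y. fourier_transform \<mu> y \<noteq> 0"
    and A: "is_cofactor \<mu> A \<alpha>" and B: "is_cofactor \<mu> B \<beta>"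
    and AB: "is_cofactor \<mu> (A o\<^sub>L B) \<gamma>"
  shows "\<gamma> = measure_convolution (image_measure A \<beta>) \<alpha>"
proof -
  have cofactor: "borel_probability \<nu>"
    "fourier_transform \<mu> y = fourier_transform \<mu> (y o\<^sub>L C) * fourier_transform \<nu> y"
    if "is_cofactor \<mu> C \<nu>" for C \<nu> y
  proof -
    show \<nu>: "borel_probability \<nu>" using that by (simp add: is_cofactor_def)
    have "\<mu> = measure_convolution (image_measure C \<mu>) \<nu>"
      using that by (simp add: is_cofactor_def)
    then have "fourier_transform \<mu> y = fourier_transform (measure_convolution (image_measure C \<mu>) \<nu>) y"
      by (rule arg_cong)
    then show "fourier_transform \<mu> y = fourier_transform \<mu> (y o\<^sub>L C) * fourier_transform \<nu> y"
      by (simp add: fourier_transform_convolution fourier_transform_image borel_probability_image \<mu>(1) \<nu>)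
  qed
  note \<alpha> = cofactor(1)[OF A] and \<beta> = cofactor(1)[OF B] and \<gamma> = cofactor(1)[OF AB]
  have conv: "borel_probability (measure_convolution (image_measure A \<beta>) \<alpha>)"
    by (intro borel_probability_convolution borel_probability_image \<alpha> \<beta>)
  have "fourier_transform \<gamma> y = fourier_transform (measure_convolution (image_measure A \<beta>) \<alpha>) y" for y
  proof -
    have assoc: "(y o\<^sub>L A) o\<^sub>L B = y o\<^sub>L (A o\<^sub>L B)"
      by (rule blinfun_eqI) simp
    have "fourier_transform \<mu> (y o\<^sub>L (A o\<^sub>L B)) * fourier_transform \<gamma> y =
        fourier_transform \<mu> y"
      using cofactor(2)[OF AB, of y] by simp
    also have "\<dots> = fourier_transform \<mu> (y o\<^sub>L (A o\<^sub>L B)) *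
          (fourier_transform \<beta> (y o\<^sub>L A) * fourier_transform \<alpha> y)"
      \<comment> \<open>The factorisation by \<open>A\<close> at \<open>y\<close> leaves the
        transform of \<open>\<mu>\<close> at \<open>y o\<^sub>L A\<close>, where the one by
        \<open>B\<close> is applied.\<close>
      using cofactor(2)[OF A, of y] cofactor(2)[OF B, of "y o\<^sub>L A"]
      by (simp add: assoc)
    finally show ?thesis
      by (simp add: \<mu>(2) fourier_transform_convolution fourier_transform_image
          borel_probability_image \<alpha> \<beta>)
  qed
  then show ?thesis
    by (intro finite_measure_eqI_fourier borel_probabilityD[OF \<gamma>] borel_probabilityD[OF conv])
qed

section \<open>Mehler operators on bounded continuous functions\<close>

lemma bcontfunD:
  assumes "f \<in> bcontfun"
  shows "continuous_on UNIV f"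
    and "\<exists>b. \<forall>x. norm (f x :: 'b::real_normed_vector) \<le> b"
  using assms by (auto simp: bcontfun_def bounded_iff)

text \<open>Continuity is dominated convergence along sequences: a bound of \<open>f\<close> is
  integrable for the probability measure \<open>\<rho> t\<close>, and it also bounds the resulting
  function.\<close>

lemma mehler_operator_bcontfun:
  assumes \<rho>: "borel_probability (\<rho> t)" and f: "f \<in> bcontfun"
  shows "mehler_operator T \<rho> t f \<in> bcontfun"
proof -
  note \<rho>D = borel_probabilityD[OF \<rho>]
  note [measurable_cong] = \<rho>D(1)
  interpret prob_space "\<rho> t" by (rule \<rho>D)
  have cont: "continuous_on UNIV f" using bcontfunD(1)[OF f] .
  obtain b where b: "\<And>x. norm (f x) \<le> b" using bcontfunD(2)[OF f] by blast
  have meas[measurable]: "(\<lambda>y. f (u + y)) \<in> borel_measurable (\<rho> t)" for u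
    unfolding measurable_cong_sets[OF \<rho>D(1) refl]
    by (intro borel_measurable_continuous_onI continuous_on_compose2[OF cont] continuous_intros) auto
  have "continuous_on UNIV (mehler_operator T \<rho> t f)"
    unfolding continuous_on_sequentially
  proof (intro allI ballI impI)
    fix X :: "nat \<Rightarrow> 'a" and x assume "(\<forall>n. X n \<in> UNIV) \<and> X \<longlonglongrightarrow> x"
    then have X: "X \<longlonglongrightarrow> x" by simp
    have "(\<lambda>n. LINT y|\<rho> t. f (T t (X n) + y)) \<longlonglongrightarrow> (LINT y|\<rho> t. f (T t x + y))"
    proof (rule integral_dominated_convergence[where w = "\<lambda>_. b"])
      show "AE y in \<rho> t. (\<lambda>n. f (T t (X n) + y)) \<longlonglongrightarrow> f (T t x + y)"
        by (intro AE_I2 continuous_on_tendsto_compose[OF cont] tendsto_intros X) auto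
    qed (auto simp: b[unfolded real_norm_def])
    then show "(mehler_operator T \<rho> t f \<circ> X) \<longlonglongrightarrow> mehler_operator T \<rho> t f x"
      by (simp add: mehler_operator_def comp_def)
  qed
  moreover have "norm (mehler_operator T \<rho> t f x) \<le> b" for x
  proof -
    have "norm (LINT y|\<rho> t. f (T t x + y)) \<le> (LINT y|\<rho> t. norm (f (T t x + y)))"
      by (rule integral_norm_bound)
    also have "\<dots> \<le> b"
    proof (rule integral_le_const)
      have "integrable (\<rho> t) (\<lambda>y. f (T t x + y))"
        by (rule integrable_bounded_borel[OF \<rho>D(3) meas b])
      then show "integrable (\<rho> t) (\<lambda>y. norm (f (T t x + y)))"
        by (rule integrable_norm)
    qed (rule AE_I2[OF b])
    finally show ?thesis by (simp add: mehler_operator_def)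
  qed
  ultimately show ?thesis
    unfolding bcontfun_def bounded_iff by blast
qed

text \<open>The iterated integrand is \<open>f (T s (T t x + y) + z)\<close>: the displacement
  \<open>y\<close> is itself transported by \<open>T s\<close>, which is why \<open>conv\<close>
  contains the image of \<open>\<rho> t\<close> under \<open>T s\<close>.\<close>

lemma mehler_operator_compose:
  assumes \<rho>: "borel_probability (\<rho> s)" "borel_probability (\<rho> t)"
    and T: "T (t + s) = T s o\<^sub>L T t"
    and conv: "\<rho> (t + s) = measure_convolution (image_measure (T s) (\<rho> t)) (\<rho> s)"
    and f: "f \<in> bcontfun"
  shows "mehler_operator T \<rho> t (mehler_operator T \<rho> s f) = mehler_operator T \<rho> (t + s) f"
proof
  fix x
  obtain b where b: "\<And>x. norm (f x) \<le> b" using bcontfunD(2)[OF f] by blast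
  define g where "g u = mehler_operator T \<rho> s f (T t x + u)" for u
  have fm[measurable]: "f \<in> borel_measurable borel"
    by (intro borel_measurable_continuous_onI bcontfunD(1) f)
  let ?h = "\<lambda>u. LINT z|\<rho> s. f (T s (T t x) + (u + z))"
  have "mehler_operator T \<rho> (t + s) f x =
      (LINT w|measure_convolution (image_measure (T s) (\<rho> t)) (\<rho> s). f (T s (T t x) + w))"
    by (simp add: mehler_operator_def conv T)
  also have "\<dots> = (LINT u|image_measure (T s) (\<rho> t). ?h u)"
    by (rule integral_measure_convolution[where b = b])
       (auto simp: b[unfolded real_norm_def] borel_probability_image \<rho>)
  also have "\<dots> = (LINT y|\<rho> t. ?h (T s y))"
  proof -
    note [measurable_cong] = borel_probabilityD(1)[OF \<rho>(1)] borel_probabilityD(1)[OF \<rho>(2)]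
    \<comment> \<open>Sigma-finiteness of \<open>\<rho> s\<close> makes the inner integral
      measurable in its parameter.\<close>
    interpret prob_space "\<rho> s" by (rule borel_probabilityD \<rho>)+
    show ?thesis unfolding image_measure_def
      by (rule integral_distr) measurable
  qed
  also have "\<dots> = mehler_operator T \<rho> t (mehler_operator T \<rho> s f) x"
    by (simp add: mehler_operator_def blinfun.add_right add.assoc)
  finally show "mehler_operator T \<rho> t (mehler_operator T \<rho> s f) x = mehler_operator T \<rho> (t + s) f x" ..
qed

theorem corollary1:
  fixes \<mu> :: "'a::{banach, second_countable_topology} measure"
    and T :: "real \<Rightarrow> 'a \<Rightarrow>\<^sub>L 'a"
    and \<rho> :: "real \<Rightarrow> 'a measure"
  assumes "borel_probability \<mu>"
    and "\<And>y. fourier_transform \<mu> y \<noteq> 0"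
    and "C0_semigroup T"
    and "\<And>t. t \<ge> 0 \<Longrightarrow> T t \<in> urbanik_semigroup \<mu>"
    and "\<And>t. t \<ge> 0 \<Longrightarrow> is_cofactor \<mu> (T t) (\<rho> t)"
  shows "generalized_mehler_semigroup (mehler_operator T \<rho>)"
proof -
  have \<rho>: "borel_probability (\<rho> t)" if "t \<ge> 0" for t
    using assms(5)[OF that] by (simp add: is_cofactor_def)
  have "mehler_operator T \<rho> t (mehler_operator T \<rho> s f) = mehler_operator T \<rho> (t + s) f"
    if "s \<ge> 0" "t \<ge> 0" "f \<in> bcontfun" for s t f
  proof (rule mehler_operator_compose)
    \<comment> \<open>Reading \<open>t + s\<close> as \<open>s + t\<close> puts \<open>T s\<close>
      outermost, as the iterated integrand requires.\<close>
    show T: "T (t + s) = T s o\<^sub>L T t"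
      using assms(3) that(1,2) unfolding C0_semigroup_def by (metis add.commute)
    show "\<rho> (t + s) = measure_convolution (image_measure (T s) (\<rho> t)) (\<rho> s)"
    proof (rule cofactor_compose[OF assms(1,2)])
      show "is_cofactor \<mu> (T s o\<^sub>L T t) (\<rho> (t + s))"
        using assms(5)[of "t + s"] that T by simp
    qed (use assms(5) that in auto)
  qed (use \<rho> that in auto)
  then show ?thesis
    unfolding generalized_mehler_semigroup_def
    using \<rho> assms(3) mehler_operator_bcontfun by blast
qed

end
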